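(* Let $A$ be a linear operator in a real or complex Hilbert space $H$ (not assumed densely defined). The following assertions are equivalent: (i) $A$ is a (densely defined) selfadjoint operator; (ii) $A$ is symmetric and there exists $c\in\mathbb{R}$, $c\neq 0$, such that $\operatorname{ran} M_{A,A}(c)=H\times H$; (iii) $A$ is symmetric and there exists $c\in\mathbb{R}$, $c\neq0$, such that $G(c^{-1}A)^{\perp}\subseteq\operatorname{ran} M_{A,A}(c)$.
   Context: A linear operator in $H$ is a (possibly unbounded) linear map from a linear subspace $\operatorname{dom}A\subseteq H$ to $H$. It is symmetric if $(Ax\,|\,y)=(x\,|\,Ay)$ for all $x,y\in\operatorname{dom}A$ (density of the domain is not required). $G(c^{-1}A)=\{(x,c^{-1}Ax):x\in\operatorname{dom}A\}$ and $\perp$ is the orthogonal complement in $H\times H$. $M_{A,A}(c)$ is the operator in $H\times H$ with domain $\operatorname{dom}A\times\operatorname{dom}A$ given by $M_{A,A}(c)(x,y)=(cx-Ay,\;Ax+cy)$. *)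

theory Defs
  imports "HOL-Analysis.Analysis"
begin

text \<open>Complex inner product spaces. The norm and topology are those of the underlying real inner
  product space with inner product \<open>Re (x | y)\<close>, so that \<open>(x | x) = \<parallel>x\<parallel>\<^sup>2\<close> (see \<open>cinner_self\<close> below).
  Inner products are linear in the first argument. A complex Hilbert space is a type of sort
  \<open>{complex_inner, complete_space}\<close>, a real one a type of sort \<open>{real_inner, complete_space}\<close>.\<close>

class complex_inner = real_inner +
  fixes scaleC :: "complex \<Rightarrow> 'a \<Rightarrow> 'a"
    and cinner :: "'a \<Rightarrow> 'a \<Rightarrow> complex"
  assumes scaleC_add_right: "scaleC a (x + y) = scaleC a x + scaleC a y"
    and scaleC_add_left: "scaleC (a + b) x = scaleC a x + scaleC b x"
    and scaleC_scaleC: "scaleC a (scaleC b x) = scaleC (a * b) x"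
    and scaleR_scaleC: "scaleR r x = scaleC (complex_of_real r) x"
    and cinner_commute: "cinner x y = cnj (cinner y x)"
    and cinner_add_left: "cinner (x + y) z = cinner x z + cinner y z"
    and cinner_scaleC_left: "cinner (scaleC a x) y = a * cinner x y"
    and inner_eq_Re_cinner: "inner x y = Re (cinner x y)"

lemma vector_space_scaleC: "vector_space (scaleC :: complex \<Rightarrow> 'a \<Rightarrow> 'a::complex_inner)"
proof
  fix x :: 'a
  show "scaleC 1 x = x"
    using scaleR_scaleC[of 1 x] by simp
qed (simp_all add: scaleC_add_right scaleC_add_left scaleC_scaleC)

lemma cinner_self: "cinner x x = complex_of_real ((norm x)\<^sup>2)"
proof -
  have "Im (cinner x x) = - Im (cinner x x)"
    using arg_cong[OF cinner_commute[of x x], of Im] by simp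
  then show ?thesis
    by (simp add: complex_eq_iff inner_eq_Re_cinner power2_norm_eq_inner)
qed

instantiation complex :: complex_inner
begin
definition "scaleC (a::complex) (x::complex) = a * x"
definition "cinner (x::complex) (y::complex) = x * cnj y"
instance
  by standard
    (simp_all add: scaleC_complex_def cinner_complex_def inner_complex_def algebra_simps
      scaleR_conv_of_real)
end

instantiation prod :: (complex_inner, complex_inner) complex_inner
begin
definition "scaleC a z = (scaleC a (fst z), scaleC a (snd z))"
definition "cinner z w = cinner (fst z) (fst w) + cinner (snd z) (snd w)"
instance
proof
  fix z w :: "'a \<times> 'b"
  show "cinner z w = cnj (cinner w z)"
    unfolding cinner_prod_def complex_cnj_add
    using cinner_commute[of "fst z" "fst w"] cinner_commute[of "snd z" "snd w"] by simp
qed (simp_all add: scaleC_prod_def cinner_prod_def inner_prod_def scaleR_prod_def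
      scaleC_add_right scaleC_add_left scaleC_scaleC scaleR_scaleC cinner_add_left
      cinner_scaleC_left inner_eq_Re_cinner distrib_left)
end

text \<open>A linear operator in \<open>H\<close> is a partial function \<open>A :: 'a \<rightharpoonup> 'a\<close>; its domain, range and graph
  are \<open>dom A\<close>, \<open>ran A\<close> and \<open>Map.graph A\<close>, and \<open>the (A x)\<close> is its value at \<open>x \<in> dom A\<close>.
  The notions below are parametrized by the scalar multiplication and the inner product in order to
  cover real spaces (\<open>scaleR\<close>, \<open>inner\<close>) and complex spaces (\<open>scaleC\<close>, \<open>cinner\<close>).\<close>

definition linear_operator ::
  "('k::comm_ring_1 \<Rightarrow> 'a::ab_group_add \<Rightarrow> 'a) \<Rightarrow> ('a \<rightharpoonup> 'a) \<Rightarrow> bool" where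
  "linear_operator smul A \<longleftrightarrow>
     module.subspace smul (dom A) \<and>
     (\<forall>x\<in>dom A. \<forall>y\<in>dom A. the (A (x + y)) = the (A x) + the (A y)) \<and>
     (\<forall>a. \<forall>x\<in>dom A. the (A (smul a x)) = smul a (the (A x)))"

definition symmetric_operator :: "('a \<Rightarrow> 'a \<Rightarrow> 'k) \<Rightarrow> ('a \<rightharpoonup> 'a) \<Rightarrow> bool" where
  "symmetric_operator ip A \<longleftrightarrow> (\<forall>x\<in>dom A. \<forall>y\<in>dom A. ip (the (A x)) y = ip x (the (A y)))"

text \<open>Only meaningful for densely defined \<open>A\<close>, where the vector \<open>z\<close> is unique.\<close>

definition adjoint_operator :: "('a \<Rightarrow> 'a \<Rightarrow> 'k) \<Rightarrow> ('a \<rightharpoonup> 'a) \<Rightarrow> ('a \<rightharpoonup> 'a)" where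
  "adjoint_operator ip A = (\<lambda>y.
     if \<exists>z. \<forall>x\<in>dom A. ip (the (A x)) y = ip x z
     then Some (THE z. \<forall>x\<in>dom A. ip (the (A x)) y = ip x z)
     else None)"

definition selfadjoint_operator ::
  "('a::topological_space \<Rightarrow> 'a \<Rightarrow> 'k) \<Rightarrow> ('a \<rightharpoonup> 'a) \<Rightarrow> bool" where
  "selfadjoint_operator ip A \<longleftrightarrow> closure (dom A) = UNIV \<and> adjoint_operator ip A = A"

definition orthogonal_complement :: "('a \<Rightarrow> 'a \<Rightarrow> 'k::zero) \<Rightarrow> 'a set \<Rightarrow> 'a set" where
  "orthogonal_complement ip S = {z. \<forall>w\<in>S. ip z w = 0}"

lemma orthogonal_complement_inner: "orthogonal_complement inner S = orthogonal_comp S"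
  by (auto simp: orthogonal_complement_def orthogonal_comp_def orthogonal_def inner_commute)

definition scaleR_operator :: "real \<Rightarrow> ('a::real_vector \<rightharpoonup> 'a) \<Rightarrow> ('a \<rightharpoonup> 'a)" where
  "scaleR_operator r A = (\<lambda>x. map_option (scaleR r) (A x))"

text \<open>The operator \<open>M\<^bsub>A,A\<^esub>(c)\<close> in \<open>H \<times> H\<close>; as \<open>c\<close> is real, \<open>scaleR\<close> also serves in the complex case
  (\<open>scaleR_scaleC\<close>).\<close>

definition M_operator ::
  "('a::real_vector \<rightharpoonup> 'a) \<Rightarrow> real \<Rightarrow> ('a \<times> 'a \<rightharpoonup> 'a \<times> 'a)" where
  "M_operator A c = (\<lambda>(x, y).
     if x \<in> dom A \<and> y \<in> dom A
     then Some (c *\<^sub>R x - the (A y), the (A x) + c *\<^sub>R y)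
     else None)"

end

theory Submission
  imports Defs
begin

text \<open>For a symmetric operator \<open>A\<close>, the vectors \<open>(- A y, c y)\<close> lie in the orthogonal complement of
  \<open>G(c\<^sup>-\<^sup>1 A)\<close>, so \<open>M(c) (x, y) = (c x, A x) + (- A y, c y)\<close> is an orthogonal decomposition along
  \<open>G(c\<^sup>-\<^sup>1 A)\<close>. If \<open>A\<close> is selfadjoint, then \<open>G(A)\<close> is closed and every element of its complement is
  of the form \<open>(- A y, y)\<close>, so \<open>M(1)\<close> is onto by the projection theorem. Conversely, if
  \<open>G(c\<^sup>-\<^sup>1 A)\<^sup>\<bottom>\<close> is contained in the range of \<open>M(c)\<close>, then the decomposition shows that it consists of
  vectors \<open>(- A y, c y)\<close> only; applied to \<open>(f, 0)\<close> with \<open>f\<close> orthogonal to the domain this gives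
  density, and applied to \<open>(- A\<^sup>* y, c y)\<close> it gives \<open>A\<^sup>* \<subseteq> A\<close>. The complex case reduces
  to the real one, because replacing \<open>x\<close> by \<open>\<i> x\<close> recovers a complex identity from its real part.\<close>

section \<open>The projection theorem for closed subspaces\<close>

lemma parallelogram_midpoint:
  fixes v s t :: "'a::real_inner"
  shows "(norm (s - t))\<^sup>2 =
    2 * (norm (v - s))\<^sup>2 + 2 * (norm (v - t))\<^sup>2 - 4 * (norm (v - (1/2) *\<^sub>R (s + t)))\<^sup>2"
proof -
  have "(v - s) + (v - t) = 2 *\<^sub>R (v - (1/2) *\<^sub>R (s + t))"
    by (simp add: scaleR_right_diff_distrib scaleR_2)
  then have "(norm ((v - s) + (v - t)))\<^sup>2 = 4 * (norm (v - (1/2) *\<^sub>R (s + t)))\<^sup>2"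
    by (simp add: power_mult_distrib)
  moreover have "(norm (p - q))\<^sup>2 = 2 * (norm p)\<^sup>2 + 2 * (norm q)\<^sup>2 - (norm (p + q))\<^sup>2"
    for p q :: 'a
    unfolding power2_norm_eq_inner
    by (simp add: inner_diff_left inner_diff_right inner_add_left inner_add_right inner_commute)
  from this[of "v - t" "v - s"]
  have "(norm (s - t))\<^sup>2 =
    2 * (norm (v - t))\<^sup>2 + 2 * (norm (v - s))\<^sup>2 - (norm ((v - s) + (v - t)))\<^sup>2"
    by (simp add: add.commute)
  ultimately show ?thesis
    by simp
qed

text \<open>The parallelogram identity makes a minimizing sequence for the distance Cauchy.
  Completeness gives a limit, and closedness keeps it in \<open>S\<close>.\<close>

lemma closed_subspace_nearest_point:
  fixes S :: "'a::{real_inner, complete_space} set"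
  assumes "closed S" and "subspace S"
  obtains s where "s \<in> S" and "\<And>w. w \<in> S \<Longrightarrow> norm (v - s) \<le> norm (v - w)"
proof -
  define D where "D = (INF s\<in>S. (norm (v - s))\<^sup>2)"
  have bdd: "bdd_below ((\<lambda>s. (norm (v - s))\<^sup>2) ` S)"
    by (rule bdd_belowI2[of _ 0]) simp
  have ne: "S \<noteq> {}"
    using subspace_0[OF assms(2)] by blast
  have D_le: "D \<le> (norm (v - w))\<^sup>2" if "w \<in> S" for w
    unfolding D_def using bdd that by (rule cINF_lower)
  have "\<exists>s\<in>S. (norm (v - s))\<^sup>2 < D + inverse (real (Suc n))" for n
    using cINF_less_iff[OF ne bdd, of "D + inverse (real (Suc n))"] by (simp add: D_def)
  then obtain s where s: "\<And>n. s n \<in> S" "\<And>n. (norm (v - s n))\<^sup>2 < D + inverse (real (Suc n))"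
    by metis
  have dist_s: "(norm (s m - s n))\<^sup>2 \<le> 2 * inverse (real (Suc m)) + 2 * inverse (real (Suc n))"
    for m n
  proof -
    \<comment> \<open>The midpoint has squared distance at least \<open>D\<close> from
      \<open>v\<close>. In the parallelogram identity all multiples of \<open>D\<close> then cancel,
      and only the error terms remain.\<close>
    have "(1/2) *\<^sub>R (s m + s n) \<in> S"
      using assms(2) s(1) by (intro subspace_scale subspace_add)
    from D_le[OF this] show ?thesis
      using s(2)[of m] s(2)[of n] parallelogram_midpoint[of "s m" "s n" v] by linarith
  qed
  have "Cauchy s"
  proof (rule CauchyI)
    fix e :: real
    assume e: "0 < e"
    then obtain N where N: "inverse (real (Suc N)) < e\<^sup>2 / 4"
      using reals_Archimedean[of "e\<^sup>2 / 4"] by auto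
    have "norm (s m - s n) < e" if "m \<ge> N" "n \<ge> N" for m n
    proof -
      have "inverse (real (Suc m)) \<le> inverse (real (Suc N))"
        "inverse (real (Suc n)) \<le> inverse (real (Suc N))"
        using that by (simp_all add: le_imp_inverse_le)
      with dist_s[of m n] N have "(norm (s m - s n))\<^sup>2 < e\<^sup>2"
        by linarith
      with e show ?thesis
        by (simp add: power2_less_imp_less)
    qed
    then show "\<exists>N. \<forall>m\<ge>N. \<forall>n\<ge>N. norm (s m - s n) < e"
      by blast
  qed
  then obtain l where l: "s \<longlonglongrightarrow> l"
    by (auto simp: Cauchy_convergent_iff convergent_def)
  have "l \<in> S"
    using closed_sequentially[OF assms(1) _ l] s(1) by blast
  moreover have "norm (v - l) \<le> norm (v - w)" if w: "w \<in> S" for w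
  proof -
    have "(\<lambda>n. (norm (v - s n))\<^sup>2) \<longlonglongrightarrow> (norm (v - l))\<^sup>2"
      by (intro tendsto_intros l)
    moreover have "(\<lambda>n. D + inverse (real (Suc n))) \<longlonglongrightarrow> D + 0"
      by (intro tendsto_intros LIMSEQ_inverse_real_of_nat)
    ultimately have "(norm (v - l))\<^sup>2 \<le> D + 0"
      by (rule LIMSEQ_le) (use s(2) less_imp_le in blast)
    with D_le[OF w] have "(norm (v - l))\<^sup>2 \<le> (norm (v - w))\<^sup>2"
      by linarith
    then show ?thesis
      by (rule power2_le_imp_le) simp
  qed
  ultimately show thesis
    by (rule that)
qed

text \<open>Take \<open>s\<close> nearest to \<open>v\<close>: if \<open>v - s\<close> were not
  orthogonal to some \<open>w\<close> in \<open>S\<close>, moving \<open>s\<close> along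
  \<open>w\<close> would come closer to \<open>v\<close>.\<close>

lemma closed_subspace_orthogonal_decomposition:
  fixes S :: "'a::{real_inner, complete_space} set"
  assumes "closed S" and "subspace S"
  obtains s where "s \<in> S" and "v - s \<in> orthogonal_comp S"
proof -
  obtain s where s: "s \<in> S" and min: "\<And>w. w \<in> S \<Longrightarrow> norm (v - s) \<le> norm (v - w)"
    using closed_subspace_nearest_point[OF assms] by blast
  have "inner (v - s) w = 0" if w: "w \<in> S" for w
  proof (rule ccontr)
    assume nz: "inner (v - s) w \<noteq> 0"
    then have ww: "inner w w > 0"
      by auto
    \<comment> \<open>The minimizer of the norm of \<open>v - s - t *\<^sub>R w\<close> over real
      \<open>t\<close>, that is, the coefficient of the projection of \<open>v - s\<close> onto the
      line through \<open>w\<close>.\<close>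
    define t where "t = inner (v - s) w / inner w w"
    have "s + t *\<^sub>R w \<in> S"
      using assms(2) s w by (intro subspace_add subspace_scale)
    from min[OF this] have "(norm (v - s))\<^sup>2 \<le> (norm (v - s - t *\<^sub>R w))\<^sup>2"
      by (simp add: power_mono diff_diff_eq)
    also have "\<dots> = (norm (v - s))\<^sup>2 - 2 * t * inner (v - s) w + t * t * inner w w"
      unfolding power2_norm_eq_inner
      by (simp add: inner_diff_left inner_diff_right inner_commute algebra_simps)
    also have "\<dots> = (norm (v - s))\<^sup>2 - (inner (v - s) w)\<^sup>2 / inner w w"
      using ww by (simp add: t_def field_simps power2_eq_square)
    finally show False
      using nz ww by (simp add: divide_le_0_iff)
  qed
  with s show thesis
    by (intro that) (auto simp: orthogonal_comp_def orthogonal_def inner_commute)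
qed

section \<open>Density and orthogonality\<close>

lemma subspace_closure:
  fixes S :: "'a::real_normed_vector set"
  assumes "subspace S"
  shows "subspace (closure S)"
  unfolding subspace_def
proof (intro conjI ballI allI)
  show "0 \<in> closure S"
    using subspace_0[OF assms] closure_subset by blast
next
  fix x y
  assume "x \<in> closure S" "y \<in> closure S"
  then obtain u v where "\<And>n. u n \<in> S" "u \<longlonglongrightarrow> x" "\<And>n. v n \<in> S" "v \<longlonglongrightarrow> y"
    unfolding closure_sequential by blast
  then have "\<forall>n. u n + v n \<in> S" "(\<lambda>n. u n + v n) \<longlonglongrightarrow> x + y"
    using assms by (auto intro: subspace_add tendsto_add)
  then show "x + y \<in> closure S"
    unfolding closure_sequential by (intro exI[of _ "\<lambda>n. u n + v n"] conjI)
next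
  fix c x
  assume "x \<in> closure S"
  then obtain u where "\<And>n. u n \<in> S" "u \<longlonglongrightarrow> x"
    unfolding closure_sequential by blast
  then have "\<forall>n. c *\<^sub>R u n \<in> S" "(\<lambda>n. c *\<^sub>R u n) \<longlonglongrightarrow> c *\<^sub>R x"
    using assms by (auto intro: subspace_scale tendsto_scaleR)
  then show "c *\<^sub>R x \<in> closure S"
    unfolding closure_sequential by (intro exI[of _ "\<lambda>n. c *\<^sub>R u n"] conjI)
qed

text \<open>Projecting \<open>v\<close> onto \<open>closure S\<close> leaves a remainder orthogonal
  to \<open>S\<close>, which must vanish.\<close>

lemma subspace_dense_if_orthogonal_trivial:
  fixes S :: "'a::{real_inner, complete_space} set"
  assumes "subspace S" and "\<And>f. f \<in> orthogonal_comp S \<Longrightarrow> f = 0"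
  shows "closure S = UNIV"
proof -
  have "v \<in> closure S" for v
  proof -
    obtain s where s: "s \<in> closure S" "v - s \<in> orthogonal_comp (closure S)"
      using closed_subspace_orthogonal_decomposition[OF closed_closure subspace_closure[OF assms(1)]]
      by blast
    have "v - s \<in> orthogonal_comp S"
      using s(2) closure_subset[of S] by (auto simp: orthogonal_comp_def)
    from assms(2)[OF this] s(1) show ?thesis
      by simp
  qed
  then show ?thesis
    by blast
qed

text \<open>The equation is a closed condition on \<open>x\<close>, so it extends to
  \<open>x = u - v\<close>. This makes values of the adjoint unique.\<close>

lemma inner_eq_on_dense:
  fixes u v :: "'a::real_inner"
  assumes "closure S = UNIV" and "\<And>x. x \<in> S \<Longrightarrow> inner x u = inner x v"
  shows "u = v"
proof -
  have "closed {x. inner x u = inner x v}"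
    by (intro closed_Collect_eq continuous_intros)
  then have "closure S \<subseteq> {x. inner x u = inner x v}"
    using assms(2) by (intro closure_minimal) auto
  with assms(1) have "inner (u - v) u = inner (u - v) v"
    by auto
  then have "inner (u - v) (u - v) = 0"
    by (simp add: inner_diff_right)
  then show ?thesis
    by simp
qed

section \<open>Adjoints and selfadjointness in real spaces\<close>

lemma adjoint_operator_inner_eq_Some_iff:
  fixes A :: "'a::real_inner \<rightharpoonup> 'a"
  assumes "closure (dom A) = UNIV"
  shows "adjoint_operator inner A y = Some z \<longleftrightarrow> (\<forall>x\<in>dom A. inner (the (A x)) y = inner x z)"
    (is "_ \<longleftrightarrow> ?P z")
proof -
  have uniq: "z1 = z2" if "?P z1" "?P z2" for z1 z2
    using that by (intro inner_eq_on_dense[OF assms]) auto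
  have the_eq: "(THE z. ?P z) = z1" if "?P z1" for z1
    using that uniq by (intro the_equality)
  show ?thesis
  proof
    assume "adjoint_operator inner A y = Some z"
    then obtain z1 where "?P z1" "(THE z. ?P z) = z"
      unfolding adjoint_operator_def by (auto split: if_splits)
    with the_eq show "?P z"
      by simp
  next
    assume "?P z"
    with the_eq show "adjoint_operator inner A y = Some z"
      unfolding adjoint_operator_def by auto
  qed
qed

text \<open>Eliminates the definite description: the real case uses selfadjointness only as this
  description of the graph of \<open>A\<close>.\<close>

lemma selfadjoint_operator_inner_iff:
  fixes A :: "'a::real_inner \<rightharpoonup> 'a"
  shows "selfadjoint_operator inner A \<longleftrightarrow> closure (dom A) = UNIV \<and>
    (\<forall>y z. A y = Some z \<longleftrightarrow> (\<forall>x\<in>dom A. inner (the (A x)) y = inner x z))"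
proof (cases "closure (dom A) = UNIV")
  case True
  have "adjoint_operator inner A = A \<longleftrightarrow> (\<forall>y z. A y = Some z \<longleftrightarrow> adjoint_operator inner A y = Some z)"
    by (metis ext option.exhaust)
  then show ?thesis
    using True by (simp add: selfadjoint_operator_def adjoint_operator_inner_eq_Some_iff)
qed (simp add: selfadjoint_operator_def)

lemma selfadjoint_imp_symmetric:
  fixes A :: "'a::real_inner \<rightharpoonup> 'a"
  assumes "selfadjoint_operator inner A"
  shows "symmetric_operator inner A"
  unfolding symmetric_operator_def
proof (intro ballI)
  fix x y
  assume "x \<in> dom A" "y \<in> dom A"
  moreover from this have "A y = Some (the (A y))"
    by auto
  ultimately show "inner (the (A x)) y = inner x (the (A y))"
    using assms unfolding selfadjoint_operator_inner_iff by blast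
qed

text \<open>The adjoint relation presents the graph as an intersection of sets, one for each
  \<open>x\<close> in the domain, that are closed by continuity of the inner product.\<close>

lemma closed_graph_selfadjoint:
  fixes A :: "'a::real_inner \<rightharpoonup> 'a"
  assumes "selfadjoint_operator inner A"
  shows "closed (Map.graph A)"
proof -
  have "Map.graph A = (\<Inter>x\<in>dom A. {p. inner (the (A x)) (fst p) = inner x (snd p)})"
    using assms by (auto simp: selfadjoint_operator_inner_iff Map.graph_def)
  moreover have "closed \<dots>"
    by (intro closed_INT ballI closed_Collect_eq continuous_intros)
  ultimately show ?thesis
    by simp
qed

section \<open>Linear operators, their graphs, and the range of \<open>M_operator\<close>\<close>

lemma linear_operator_scaleR_iff:
  "linear_operator scaleR A \<longleftrightarrow> subspace (dom A) \<and>
     (\<forall>x\<in>dom A. \<forall>y\<in>dom A. the (A (x + y)) = the (A x) + the (A y)) \<and>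
     (\<forall>a. \<forall>x\<in>dom A. the (A (a *\<^sub>R x)) = a *\<^sub>R the (A x))"
  by (simp add: linear_operator_def subspace_raw_def)

lemma linear_operator_zero:
  fixes A :: "'a::real_vector \<rightharpoonup> 'a"
  assumes "linear_operator scaleR A"
  shows "A 0 = Some 0"
proof -
  have "0 \<in> dom A"
    using assms subspace_0 unfolding linear_operator_scaleR_iff by blast
  moreover from this have "the (A (0 *\<^sub>R 0)) = 0 *\<^sub>R the (A 0)"
    using assms unfolding linear_operator_scaleR_iff by blast
  ultimately show ?thesis
    by auto
qed

lemma subspace_graph:
  fixes A :: "'a::real_vector \<rightharpoonup> 'a"
  assumes "linear_operator scaleR A"
  shows "subspace (Map.graph A)"
proof -
  note A = assms[unfolded linear_operator_scaleR_iff]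
  \<comment> \<open>Used from right to left, to bring graph membership into the terms in which
    linearity is stated.\<close>
  have dom: "x \<in> dom A \<and> the (A x) = y \<longleftrightarrow> (x, y) \<in> Map.graph A" for x y
    by (auto simp: Map.graph_def)
  show ?thesis
    unfolding subspace_def
  proof (intro conjI ballI allI)
    show "0 \<in> Map.graph A"
      using linear_operator_zero[OF assms] by (simp add: Map.graph_def zero_prod_def)
    show "p + q \<in> Map.graph A" if "p \<in> Map.graph A" "q \<in> Map.graph A" for p q
      using that A by (cases p; cases q) (simp flip: dom add: subspace_add)
    show "c *\<^sub>R p \<in> Map.graph A" if "p \<in> Map.graph A" for c p
      using that A by (cases p) (simp flip: dom add: subspace_scale)
  qed
qed

lemma mem_orthogonal_complement_graph:
  fixes A :: "'a::real_inner \<rightharpoonup> 'a"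
  shows "(p, q) \<in> orthogonal_complement inner (Map.graph (scaleR_operator r A)) \<longleftrightarrow>
    (\<forall>x\<in>dom A. inner p x + inner q (r *\<^sub>R the (A x)) = 0)"
proof -
  have "Map.graph (scaleR_operator r A) = (\<lambda>x. (x, r *\<^sub>R the (A x))) ` dom A"
    by (force simp: Map.graph_def scaleR_operator_def)
  then show ?thesis
    by (simp add: orthogonal_complement_def)
qed

lemma mem_ran_M_operator:
  "(f, g) \<in> ran (M_operator A c) \<longleftrightarrow>
    (\<exists>x\<in>dom A. \<exists>y\<in>dom A. f = c *\<^sub>R x - the (A y) \<and> g = the (A x) + c *\<^sub>R y)"
proof -
  have "ran (M_operator A c) =
    (\<lambda>(x, y). (c *\<^sub>R x - the (A y), the (A x) + c *\<^sub>R y)) ` (dom A \<times> dom A)"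
    by (force simp: ran_def M_operator_def split: if_splits)
  then show ?thesis
    by (auto simp: image_iff)
qed

section \<open>The equivalences in real Hilbert spaces\<close>

lemma selfadjoint_imp_ran_M_operator:
  fixes A :: "'a::{real_inner, complete_space} \<rightharpoonup> 'a"
  assumes lin: "linear_operator scaleR A" and sa: "selfadjoint_operator inner A"
  shows "ran (M_operator A 1) = UNIV"
proof -
  have "(f, g) \<in> ran (M_operator A 1)" for f g
  proof -
    obtain s where s: "s \<in> Map.graph A" "(f, g) - s \<in> orthogonal_comp (Map.graph A)"
      using closed_subspace_orthogonal_decomposition
        [OF closed_graph_selfadjoint[OF sa] subspace_graph[OF lin]] by blast
    then obtain x z where x: "s = (x, z)" "A x = Some z"
      by (cases s) (auto simp: Map.graph_def)
    \<comment> \<open>Orthogonality of the remainder \<open>(f - x, g - z)\<close> to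
      \<open>(u, the (A u))\<close> is the adjoint relation for \<open>g - z\<close> with value
      \<open>x - f\<close>. Hence \<open>(x, g - z)\<close> is a preimage of
      \<open>(f, g)\<close>.\<close>
    have orth: "inner (the (A u)) (g - z) = inner u (x - f)" if "u \<in> dom A" for u
    proof -
      have "(u, the (A u)) \<in> Map.graph A"
        using that by (auto simp: Map.graph_def)
      with s(2) have "inner u (f - x) + inner (the (A u)) (g - z) = 0"
        by (auto simp: x orthogonal_comp_def orthogonal_def)
      then show ?thesis
        by (simp add: inner_diff_right)
    qed
    then have "A (g - z) = Some (x - f)"
      using sa by (simp add: selfadjoint_operator_inner_iff)
    with x(2) show ?thesis
      unfolding mem_ran_M_operator
      by (intro bexI[of _ x] bexI[of _ "g - z"]) auto
  qed
  then show ?thesis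
    by auto
qed

text \<open>With \<open>(p, q)\<close> the image of \<open>(x, y)\<close>, the hypothesis is tested
  at this same \<open>x\<close>. Symmetry cancels the terms in \<open>y\<close>, leaving two terms
  of the same sign that add up to zero and so force \<open>x = 0\<close>.\<close>

lemma orthogonal_complement_graph_imp_eq:
  fixes A :: "'a::real_inner \<rightharpoonup> 'a"
  assumes sym: "symmetric_operator inner A" and c: "c \<noteq> 0"
    and sub: "orthogonal_complement inner (Map.graph (scaleR_operator (inverse c) A))
      \<subseteq> ran (M_operator A c)"
    and orth: "\<And>x. x \<in> dom A \<Longrightarrow> inner p x + inner q (inverse c *\<^sub>R the (A x)) = 0"
  obtains y where "y \<in> dom A" and "p = - the (A y)" and "q = c *\<^sub>R y"
proof -
  have "(p, q) \<in> ran (M_operator A c)"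
    using sub orth mem_orthogonal_complement_graph by blast
  then obtain x y where xy: "x \<in> dom A" "y \<in> dom A"
    and p: "p = c *\<^sub>R x - the (A y)" and q: "q = the (A x) + c *\<^sub>R y"
    unfolding mem_ran_M_operator by blast
  have "inner (the (A y)) x = inner y (the (A x))"
    using sym xy by (simp add: symmetric_operator_def)
  then have "inner p x = c * inner x x - inner y (the (A x))"
    by (simp add: p inner_diff_left)
  moreover have "inner q (inverse c *\<^sub>R the (A x)) =
      inverse c * inner (the (A x)) (the (A x)) + inner y (the (A x))"
    using c by (simp add: q inner_add_left distrib_left)
  ultimately have "c * inner x x + inverse c * inner (the (A x)) (the (A x)) = 0"
    using orth[OF xy(1)] by linarith
  \<comment> \<open>The factor \<open>c\<close> yields a sum of squares whatever the sign of
    \<open>c\<close>.\<close>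
  then have "c * (c * inner x x + inverse c * inner (the (A x)) (the (A x))) = 0"
    by simp
  with c have "(norm (c *\<^sub>R x))\<^sup>2 + (norm (the (A x)))\<^sup>2 = 0"
    unfolding power2_norm_eq_inner by (simp add: distrib_left flip: mult.assoc)
  then have "c *\<^sub>R x = 0" "the (A x) = 0"
    by (simp_all add: sum_power2_eq_zero_iff)
  with p q xy(2) that show thesis
    by simp
qed

lemma selfadjoint_if_orthogonal_complement_subset:
  fixes A :: "'a::{real_inner, complete_space} \<rightharpoonup> 'a"
  assumes lin: "linear_operator scaleR A" and sym: "symmetric_operator inner A" and c: "c \<noteq> 0"
    and sub: "orthogonal_complement inner (Map.graph (scaleR_operator (inverse c) A))
      \<subseteq> ran (M_operator A c)"
  shows "selfadjoint_operator inner A"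
  unfolding selfadjoint_operator_inner_iff
proof (intro conjI allI iffI ballI)
  show "closure (dom A) = UNIV"
  proof (rule subspace_dense_if_orthogonal_trivial)
    show "subspace (dom A)"
      using lin by (simp add: linear_operator_scaleR_iff)
    fix f
    assume "f \<in> orthogonal_comp (dom A)"
    \<comment> \<open>The pair \<open>(f, 0)\<close> is orthogonal to the graph. The resulting
      \<open>y\<close> satisfies \<open>c *\<^sub>R y = 0\<close>, so \<open>y = 0\<close> and
      \<open>f = - the (A 0) = 0\<close>.\<close>
    then have "inner f x + inner 0 (inverse c *\<^sub>R the (A x)) = 0" if "x \<in> dom A" for x
      using that by (auto simp: orthogonal_comp_def orthogonal_def inner_commute)
    then obtain y where "f = - the (A y)" "0 = c *\<^sub>R y"
      using orthogonal_complement_graph_imp_eq[OF sym c sub] by metis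
    with c linear_operator_zero[OF lin] show "f = 0"
      by simp
  qed
next
  fix y z
  assume adj: "\<forall>x\<in>dom A. inner (the (A x)) y = inner x z"
  \<comment> \<open>The factors \<open>c\<close> and \<open>inverse c\<close> cancel, so this is the
    adjoint relation for \<open>y\<close> and \<open>z\<close>. The vector \<open>y'\<close>
    obtained next equals \<open>y\<close>, which puts \<open>y\<close> into the domain.\<close>
  have "inner (- z) x + inner (c *\<^sub>R y) (inverse c *\<^sub>R the (A x)) = 0" if "x \<in> dom A" for x
    using adj that c by (simp add: inner_commute)
  then obtain y' where "y' \<in> dom A" "- z = - the (A y')" "c *\<^sub>R y = c *\<^sub>R y'"
    using orthogonal_complement_graph_imp_eq[OF sym c sub] by metis
  with c show "A y = Some z"
    by auto
next
  fix y z x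
  assume "A y = Some z" "x \<in> dom A"
  with sym show "inner (the (A x)) y = inner x z"
    by (metis domI option.sel symmetric_operator_def)
qed

text \<open>A cycle of implications: selfadjointness gives surjectivity with \<open>c = 1\<close>,
  surjectivity gives the inclusion with the same \<open>c\<close>, and the inclusion gives
  selfadjointness.\<close>

lemma selfadjoint_operator_inner_characterization:
  fixes A :: "'a::{real_inner, complete_space} \<rightharpoonup> 'a"
  assumes "linear_operator scaleR A"
  shows "selfadjoint_operator inner A \<longleftrightarrow>
      symmetric_operator inner A \<and> (\<exists>c::real. c \<noteq> 0 \<and> ran (M_operator A c) = UNIV)"
    and "selfadjoint_operator inner A \<longleftrightarrow>
      symmetric_operator inner A \<and>
      (\<exists>c::real. c \<noteq> 0 \<and>
         orthogonal_complement inner (Map.graph (scaleR_operator (inverse c) A))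
           \<subseteq> ran (M_operator A c))"
proof -
  have "selfadjoint_operator inner A \<Longrightarrow>
      symmetric_operator inner A \<and> (\<exists>c::real. c \<noteq> 0 \<and> ran (M_operator A c) = UNIV)"
    using selfadjoint_imp_symmetric selfadjoint_imp_ran_M_operator[OF assms] zero_neq_one by metis
  moreover have "selfadjoint_operator inner A" if "symmetric_operator inner A" "c \<noteq> 0"
    "orthogonal_complement inner (Map.graph (scaleR_operator (inverse c) A)) \<subseteq> ran (M_operator A c)"
    for c
    using selfadjoint_if_orthogonal_complement_subset[OF assms that] .
  ultimately show "selfadjoint_operator inner A \<longleftrightarrow>
      symmetric_operator inner A \<and> (\<exists>c::real. c \<noteq> 0 \<and> ran (M_operator A c) = UNIV)"
    and "selfadjoint_operator inner A \<longleftrightarrow>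
      symmetric_operator inner A \<and>
      (\<exists>c::real. c \<noteq> 0 \<and>
         orthogonal_complement inner (Map.graph (scaleR_operator (inverse c) A))
           \<subseteq> ran (M_operator A c))"
    by (blast intro: equalityD2)+
qed

section \<open>Reduction of the complex case to the real one\<close>

lemma linear_operator_scaleC_imp_scaleR:
  fixes B :: "'b::complex_inner \<rightharpoonup> 'b"
  assumes "linear_operator scaleC B"
  shows "linear_operator scaleR B"
proof -
  interpret complex: vector_space "scaleC :: complex \<Rightarrow> 'b \<Rightarrow> 'b"
    by (rule vector_space_scaleC)
  show ?thesis
    using assms unfolding linear_operator_scaleR_iff
    by (simp add: linear_operator_def complex.subspace_def subspace_def scaleR_scaleC)
qed

lemma linear_operator_scaleC_D:
  fixes B :: "'b::complex_inner \<rightharpoonup> 'b"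
  assumes "linear_operator scaleC B" and "x \<in> dom B"
  shows "scaleC a x \<in> dom B" and "the (B (scaleC a x)) = scaleC a (the (B x))"
proof -
  interpret complex: vector_space "scaleC :: complex \<Rightarrow> 'b \<Rightarrow> 'b"
    by (rule vector_space_scaleC)
  show "scaleC a x \<in> dom B" "the (B (scaleC a x)) = scaleC a (the (B x))"
    using assms by (simp_all add: linear_operator_def complex.subspace_scale)
qed

text \<open>The real part of \<open>cinner (scaleC \<i> u) y\<close> is minus the imaginary part of
  \<open>cinner u y\<close>.\<close>

lemma cinner_eq_iff_inner_eq:
  "cinner u y = cinner v z \<longleftrightarrow>
    inner u y = inner v z \<and> inner (scaleC \<i> u) y = inner (scaleC \<i> v) z"
  by (auto simp: complex_eq_iff inner_eq_Re_cinner cinner_scaleC_left)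

text \<open>The domain is stable under \<i> and \<open>B\<close> commutes with it, so the real
  relation at \<open>scaleC \<i> x\<close> supplies the imaginary part at \<open>x\<close>.\<close>

lemma adjoint_relation_cinner_iff:
  fixes B :: "'b::complex_inner \<rightharpoonup> 'b"
  assumes "linear_operator scaleC B"
  shows "(\<forall>x\<in>dom B. cinner (the (B x)) y = cinner x z) \<longleftrightarrow>
    (\<forall>x\<in>dom B. inner (the (B x)) y = inner x z)"
proof
  assume "\<forall>x\<in>dom B. inner (the (B x)) y = inner x z"
  then have "inner (scaleC \<i> (the (B x))) y = inner (scaleC \<i> x) z" if "x \<in> dom B" for x
    using linear_operator_scaleC_D[OF assms that, of \<i>] by metis
  with \<open>\<forall>x\<in>dom B. inner (the (B x)) y = inner x z\<close>
  show "\<forall>x\<in>dom B. cinner (the (B x)) y = cinner x z"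
    unfolding cinner_eq_iff_inner_eq by blast
qed (simp add: inner_eq_Re_cinner)

lemma symmetric_operator_cinner_iff:
  fixes B :: "'b::complex_inner \<rightharpoonup> 'b"
  assumes "linear_operator scaleC B"
  shows "symmetric_operator cinner B \<longleftrightarrow> symmetric_operator inner B"
  unfolding symmetric_operator_def using adjoint_relation_cinner_iff[OF assms] by blast

text \<open>Both adjoints come from the same relation, and density refers to the same
  topology.\<close>

lemma selfadjoint_operator_cinner_iff:
  fixes B :: "'b::complex_inner \<rightharpoonup> 'b"
  assumes "linear_operator scaleC B"
  shows "selfadjoint_operator cinner B \<longleftrightarrow> selfadjoint_operator inner B"
  unfolding selfadjoint_operator_def adjoint_operator_def adjoint_relation_cinner_iff[OF assms] ..

text \<open>The real part of \<open>cinner z (scaleC \<i> w)\<close> is the imaginary part of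
  \<open>cinner z w\<close>.\<close>

lemma orthogonal_complement_cinner:
  fixes S :: "'b::complex_inner set"
  assumes "\<And>w. w \<in> S \<Longrightarrow> scaleC \<i> w \<in> S"
  shows "orthogonal_complement cinner S = orthogonal_complement inner S"
proof -
  have "cinner z w = 0 \<longleftrightarrow> inner z w = 0 \<and> inner z (scaleC \<i> w) = 0" for z w :: 'b
    using cinner_commute[of z w] cinner_commute[of z "scaleC \<i> w"]
    by (auto simp: complex_eq_iff inner_eq_Re_cinner cinner_scaleC_left)
  then show ?thesis
    using assms by (auto simp: orthogonal_complement_def)
qed

lemma orthogonal_complement_cinner_graph:
  fixes B :: "'b::complex_inner \<rightharpoonup> 'b"
  assumes "linear_operator scaleC B"
  shows "orthogonal_complement cinner (Map.graph (scaleR_operator r B)) =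
    orthogonal_complement inner (Map.graph (scaleR_operator r B))"
proof (rule orthogonal_complement_cinner)
  fix w
  assume "w \<in> Map.graph (scaleR_operator r B)"
  then obtain x z where w: "w = (x, r *\<^sub>R z)" "B x = Some z"
    by (cases w) (auto simp: Map.graph_def scaleR_operator_def)
  then have "B (scaleC \<i> x) = Some (scaleC \<i> z)"
    using linear_operator_scaleC_D[OF assms domI[where m = B, OF w(2)], of \<i>] by auto
  then show "scaleC \<i> w \<in> Map.graph (scaleR_operator r B)"
    by (simp add: w(1) Map.graph_def scaleR_operator_def scaleC_prod_def scaleR_scaleC
        scaleC_scaleC mult.commute)
qed

text \<open>Every complex notion is replaced by its real counterpart; \<open>M_operator\<close>
  involves only real scalars and stays as it is.\<close>

lemma selfadjoint_operator_cinner_characterization: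
  fixes B :: "'b::{complex_inner, complete_space} \<rightharpoonup> 'b"
  assumes "linear_operator scaleC B"
  shows "selfadjoint_operator cinner B \<longleftrightarrow>
      symmetric_operator cinner B \<and> (\<exists>c::real. c \<noteq> 0 \<and> ran (M_operator B c) = UNIV)"
    and "selfadjoint_operator cinner B \<longleftrightarrow>
      symmetric_operator cinner B \<and>
      (\<exists>c::real. c \<noteq> 0 \<and>
         orthogonal_complement cinner (Map.graph (scaleR_operator (inverse c) B))
           \<subseteq> ran (M_operator B c))"
  unfolding selfadjoint_operator_cinner_iff[OF assms] symmetric_operator_cinner_iff[OF assms]
    orthogonal_complement_cinner_graph[OF assms]
  by (rule selfadjoint_operator_inner_characterization
      [OF linear_operator_scaleC_imp_scaleR[OF assms]])+

theorem theorem3p1: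
  fixes A :: "'a::{real_inner, complete_space} \<rightharpoonup> 'a"
    and B :: "'b::{complex_inner, complete_space} \<rightharpoonup> 'b"
  shows
    "(linear_operator scaleR A \<longrightarrow>
       (selfadjoint_operator inner A \<longleftrightarrow>
          symmetric_operator inner A \<and> (\<exists>c::real. c \<noteq> 0 \<and> ran (M_operator A c) = UNIV)) \<and>
       (selfadjoint_operator inner A \<longleftrightarrow>
          symmetric_operator inner A \<and>
          (\<exists>c::real. c \<noteq> 0 \<and>
             orthogonal_complement inner (Map.graph (scaleR_operator (inverse c) A))
               \<subseteq> ran (M_operator A c)))) \<and>
     (linear_operator scaleC B \<longrightarrow>
       (selfadjoint_operator cinner B \<longleftrightarrow>
          symmetric_operator cinner B \<and> (\<exists>c::real. c \<noteq> 0 \<and> ran (M_operator B c) = UNIV)) \<and>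
       (selfadjoint_operator cinner B \<longleftrightarrow>
          symmetric_operator cinner B \<and>
          (\<exists>c::real. c \<noteq> 0 \<and>
             orthogonal_complement cinner (Map.graph (scaleR_operator (inverse c) B))
               \<subseteq> ran (M_operator B c))))"
  by (intro conjI impI selfadjoint_operator_inner_characterization
      selfadjoint_operator_cinner_characterization)

end
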